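(* Suppose that for all integers $1\le t<k$ and all $g\in\mathcal G_t^\star$ one has $f(x|k,g,\phi_k)=f(x|t,g,\phi_t)$, and that for all $1\le t<k$ the ratio $f(g|k,\alpha_k)/f(g|t,\alpha_t)$ takes one and the same value $a_{kt}$ for all $g\in\mathcal G_t^\star$; put $a_{kk}=1$. Then for every $k\ge1$ $$f_k=\sum_{r=1}^k a_{kr}\sum_{h\in\mathcal H_r^r}\gamma_h^{r,k}f_h^\dagger,\qquad\text{where}\quad \gamma_h^{r,k}=\frac1{\gamma_h^r}\sum_{t=r}^k\gamma_h^t .$$ Moreover, for every $k\ge2$, $$f_k=a_{k,k-1}f_{k-1}+\sum_{r=1}^k a_{kr}\sum_{h\in\mathcal H_r^r}\frac{\gamma_h^k}{\gamma_h^r}f_h^\dagger .$$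
   Context: Fix $n\ge1$ and data $x=(x_1,\dots,x_n)$. For each integer $k\ge1$ consider a mixture model with $k$ components. Its $j$th component ($1\le j\le k$) has density $p_{jk}(\cdot|\theta_{jk})$, the parameter $\theta_{jk}$ has prior probability density $\pi_{jk}(\cdot|\phi_{jk})$ with fixed hyperparameter $\phi_{jk}$, parameters being independent over $j$; the weights have a Dirichlet prior with hyperparameters $\alpha_{jk}>0$. Write $\phi_k=(\phi_{1k},\dots,\phi_{kk})$, $\alpha_k=(\alpha_{1k},\dots,\alpha_{kk})$, $\alpha_{0k}=\sum_{j=1}^k\alpha_{jk}$. Let $\mathcal G_k=\{1,\dots,k\}^n$ be the set of membership vectors $g=(g_1,\dots,g_n)$, so that $\mathcal G_t\subset\mathcal G_k$ for $t<k$. For $g\in\mathcal G_k$ let $A_j=\{i:g_i=j\}$, $n_j=\operatorname{card}(A_j)$, $x^j=\{x_i:i\in A_j\}$. After integrating out weights and component parameters, $$f(g|k,\alpha_k)=\frac{\Gamma(\alpha_{0k})}{\Gamma(\alpha_{0k}+n)}\prod_{j=1}^k\frac{\Gamma(\alpha_{jk}+n_j)}{\Gamma(\alpha_{jk})},\qquad f(x|k,g,\phi_k)=\prod_{j=1}^k q_{jk}(x^j|\phi_{jk}),$$ $$q_{jk}(x^j|\phi_{jk})=\int\prod_{i\in A_j}p_{jk}(x_i|\theta)\,\pi_{jk}(\theta|\phi_{jk})\,d\theta,$$ which are assumed finite (and $q_{jk}=1$ when $A_j=\varnothing$). The marginal likelihood is $f_k=\sum_{g\in\mathcal G_k}f(x|k,g,\phi_k)f(g|k,\alpha_k)$.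 Standing assumptions: for all $k\ge2$ and $1\le j\le k-1$, $\alpha_{jk}=\alpha_{jj}$, $p_{jk}(\cdot|\cdot)=p_{jj}(\cdot|\cdot)$, $\pi_{jk}(\cdot|\cdot)=\pi_{jj}(\cdot|\cdot)$, $\phi_{jk}=\phi_{jj}$. Let $\mathcal G_t^\star=\{g\in\mathcal G_t:\exists\, i\text{ with }g_i=t\}$. Equivalence classes. Components $j$ and $k$ are equivalent (alike) if $\alpha_{jj}=\alpha_{kk}$, $p_{jj}(\cdot|\cdot)=p_{kk}(\cdot|\cdot)$, $\pi_{jj}(\cdot|\cdot)=\pi_{kk}(\cdot|\cdot)$ and $\phi_{jj}=\phi_{kk}$. This partitions the components $\{1,2,\dots\}$ into classes $\mathcal C(1),\mathcal C(2),\dots$, ordered by their smallest elements. $N(t)$ is the number of classes that meet $\{1,\dots,t\}$, $i(t)$ is the index of the class containing $t$, and $c(m,t)=\operatorname{card}(\mathcal C(m)\cap\{1,\dots,t\})$. Occupancy patterns. The class occupancy pattern of $g\in\mathcal G_t^\star$ is $h=(h_1,\dots,h_{N(t)})$, with $h_m$ the number of nonempty components (those $j$ with $n_j\ge1$) in $\mathcal C(m)$. Patterns differing only by trailing zeros are identified. The set $\mathcal H_t$ of patterns of elements of $\mathcal G_t^\star$ consists of the $h=(h_1,\dots,h_{N(t)})$ with $\sum_m h_m\le n$, $h_{i(t)}\in\{1,\dots,c(i(t),t)\}$ and $h_m\in\{0,\dots,c(m,t)\}$ for $m\ne i(t)$. Let $s(h)=\min\{r:c(m,r)\ge h_m\text{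 for all }m\}$ and $\mathcal H_r^t=\{h\in\mathcal H_t:s(h)=r\}$; in particular $\mathcal H_r^r=\{h\in\mathcal H_r:s(h)=r\}$. Let $\mathcal G_h^t$ be the set of $g\in\mathcal G_t^\star$ with class occupancy pattern $h$. Define $$\gamma_h^t=\frac{h_{i(t)}}{c(i(t),t)}\prod_{m=1}^{N(t)}\binom{c(m,t)}{h_m}\ \text{ if }h\in\mathcal H_t,\qquad \gamma_h^t=0\ \text{ if }h\notin\mathcal H_t,$$ $$f_h^\dagger=\sum_{g\in\mathcal G_h^{s}}f(x|s,g,\phi_s)f(g|s,\alpha_s),\qquad s=s(h).$$ *)

theory Defs
  imports "HOL-Analysis.Analysis"
begin

text \<open>
  The parameter space of component \<open>j\<close> of the \<open>k\<close>-component mixture is the measure space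
  \<open>param_space j k\<close>; its measure is the reference measure \<open>d\<theta>\<close> in the definition of \<open>q\<close>, so that
  parameter spaces may differ between components. Component indices start at \<open>1\<close>.
  Arguments to the right of the conditioning bar come first:
  \<open>comp_dens M j k \<theta> y\<close> is \<open>p\<^sub>j\<^sub>k(y|\<theta>)\<close> and \<open>prior_dens M j k \<phi> \<theta>\<close> is \<open>\<pi>\<^sub>j\<^sub>k(\<theta>|\<phi>)\<close>.
\<close>

record ('x, 'th, 'ph) mixture_family =
  data_space :: "'x measure"
  param_space :: "nat \<Rightarrow> nat \<Rightarrow> 'th measure"
  comp_dens :: "nat \<Rightarrow> nat \<Rightarrow> 'th \<Rightarrow> 'x \<Rightarrow> real"
  prior_dens :: "nat \<Rightarrow> nat \<Rightarrow> 'ph \<Rightarrow> 'th \<Rightarrow> real"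
  hyper :: "nat \<Rightarrow> nat \<Rightarrow> 'ph"
  dir_par :: "nat \<Rightarrow> nat \<Rightarrow> real"

definition prob_density :: "'a measure \<Rightarrow> ('a \<Rightarrow> real) \<Rightarrow> bool" where
  "prob_density M f \<longleftrightarrow> f \<in> borel_measurable M \<and> (\<forall>y\<in>space M. 0 \<le> f y) \<and>
     (\<integral>\<^sup>+ y. ennreal (f y) \<partial>M) = 1"

text \<open>
  Membership vectors are extensional functions on \<open>{1..n}\<close>; hence
  \<open>memb n t \<subseteq> memb n k\<close> for \<open>t \<le> k\<close>.
\<close>

definition memb :: "nat \<Rightarrow> nat \<Rightarrow> (nat \<Rightarrow> nat) set" where
  "memb n k = {1..n} \<rightarrow>\<^sub>E {1..k}"

definition memb_star :: "nat \<Rightarrow> nat \<Rightarrow> (nat \<Rightarrow> nat) set" where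
  "memb_star n t = {g \<in> memb n t. \<exists>i\<in>{1..n}. g i = t}"

definition alloc :: "nat \<Rightarrow> (nat \<Rightarrow> nat) \<Rightarrow> nat \<Rightarrow> nat set" where
  "alloc n g j = {i \<in> {1..n}. g i = j}"


subsection \<open>Marginal likelihoods\<close>

definition q_integrand ::
  "('x, 'th, 'ph) mixture_family \<Rightarrow> (nat \<Rightarrow> 'x) \<Rightarrow> nat \<Rightarrow> nat \<Rightarrow> nat set \<Rightarrow> 'th \<Rightarrow> real" where
  "q_integrand M x j k A \<theta> =
     (\<Prod>i\<in>A. comp_dens M j k \<theta> (x i)) * prior_dens M j k (hyper M j k) \<theta>"

definition q_marg ::
  "('x, 'th, 'ph) mixture_family \<Rightarrow> (nat \<Rightarrow> 'x) \<Rightarrow> nat \<Rightarrow> nat \<Rightarrow> nat set \<Rightarrow> real" where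
  "q_marg M x j k A = (LINT \<theta>|param_space M j k. q_integrand M x j k A \<theta>)"

definition f_data ::
  "('x, 'th, 'ph) mixture_family \<Rightarrow> nat \<Rightarrow> (nat \<Rightarrow> 'x) \<Rightarrow> nat \<Rightarrow> (nat \<Rightarrow> nat) \<Rightarrow> real" where
  "f_data M n x k g = (\<Prod>j=1..k. q_marg M x j k (alloc n g j))"

definition dir_total :: "('x, 'th, 'ph) mixture_family \<Rightarrow> nat \<Rightarrow> real" where
  "dir_total M k = (\<Sum>j=1..k. dir_par M j k)"

definition f_memb :: "('x, 'th, 'ph) mixture_family \<Rightarrow> nat \<Rightarrow> nat \<Rightarrow> (nat \<Rightarrow> nat) \<Rightarrow> real" where
  "f_memb M n k g =
     Gamma (dir_total M k) / Gamma (dir_total M k + real n) *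
     (\<Prod>j=1..k. Gamma (dir_par M j k + real (card (alloc n g j))) / Gamma (dir_par M j k))"

definition f_marg :: "('x, 'th, 'ph) mixture_family \<Rightarrow> nat \<Rightarrow> (nat \<Rightarrow> 'x) \<Rightarrow> nat \<Rightarrow> real" where
  "f_marg M n x k = (\<Sum>g\<in>memb n k. f_data M n x k g * f_memb M n k g)"


subsection \<open>The model\<close>

text \<open>
  Finiteness of the \<open>q\<^sub>j\<^sub>k\<close> is integrability of the integrand. That \<open>q\<^sub>j\<^sub>k = 1\<close> for an empty component
  is a consequence of the prior being a probability density (\<open>q_marg_empty\<close> below).
\<close>

definition mixture_model :: "('x, 'th, 'ph) mixture_family \<Rightarrow> nat \<Rightarrow> (nat \<Rightarrow> 'x) \<Rightarrow> bool" where
  "mixture_model M n x \<longleftrightarrow>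
     n \<ge> 1 \<and> (\<forall>i\<in>{1..n}. x i \<in> space (data_space M)) \<and>
     (\<forall>k\<ge>1. \<forall>j\<in>{1..k}.
        (\<forall>\<theta>\<in>space (param_space M j k). prob_density (data_space M) (comp_dens M j k \<theta>)) \<and>
        prob_density (param_space M j k) (prior_dens M j k (hyper M j k)) \<and>
        dir_par M j k > 0 \<and>
        (\<forall>g\<in>memb n k. integrable (param_space M j k) (q_integrand M x j k (alloc n g j))))"

text \<open>
  Equality of the densities \<open>\<pi>\<close> includes equality of the measure spaces on which they are densities.
\<close>

definition nested_components :: "('x, 'th, 'ph) mixture_family \<Rightarrow> bool" where
  "nested_components M \<longleftrightarrow>
     (\<forall>k\<ge>2. \<forall>j\<in>{1..k-1}.
        dir_par M j k = dir_par M j j \<and> comp_dens M j k = comp_dens M j j \<and>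
        param_space M j k = param_space M j j \<and> prior_dens M j k = prior_dens M j j \<and>
        hyper M j k = hyper M j j)"

lemma q_marg_empty:
  assumes "mixture_model M n x" "j \<in> {1..k}"
  shows "q_marg M x j k {} = 1"
proof -
  let ?P = "param_space M j k" and ?f = "prior_dens M j k (hyper M j k)"
  have "prob_density ?P ?f"
    using assms by (auto simp: mixture_model_def)
  then have "?f \<in> borel_measurable ?P" "AE y in ?P. 0 \<le> ?f y" "(\<integral>\<^sup>+ y. ennreal (?f y) \<partial>?P) = 1"
    by (auto simp: prob_density_def)
  then have "integral\<^sup>L ?P ?f = 1"
    by (simp add: integral_eq_nn_integral)
  then show ?thesis
    by (simp add: q_marg_def q_integrand_def)
qed


subsection \<open>Classes of alike components\<close>

definition alike :: "('x, 'th, 'ph) mixture_family \<Rightarrow> nat \<Rightarrow> nat \<Rightarrow> bool" where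
  "alike M j k \<longleftrightarrow>
     dir_par M j j = dir_par M k k \<and> comp_dens M j j = comp_dens M k k \<and>
     param_space M j j = param_space M k k \<and> prior_dens M j j = prior_dens M k k \<and>
     hyper M j j = hyper M k k"

definition comp_classes :: "('x, 'th, 'ph) mixture_family \<Rightarrow> nat set set" where
  "comp_classes M = {1..} // {(j, k). j \<ge> 1 \<and> k \<ge> 1 \<and> alike M j k}"

text \<open>
  The classes numbered \<open>1, 2, \<dots>\<close> by their smallest elements; \<open>comp_class M m\<close> is empty
  if there is no \<open>m\<close>-th class, in particular for \<open>m = 0\<close>.
\<close>

definition class_rank :: "('x, 'th, 'ph) mixture_family \<Rightarrow> nat set \<Rightarrow> nat" where
  "class_rank M B = card {B' \<in> comp_classes M. (LEAST j. j \<in> B') \<le> (LEAST j. j \<in> B)}"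

definition comp_class :: "('x, 'th, 'ph) mixture_family \<Rightarrow> nat \<Rightarrow> nat set" where
  "comp_class M m = \<Union>{B \<in> comp_classes M. class_rank M B = m}"

definition num_classes :: "('x, 'th, 'ph) mixture_family \<Rightarrow> nat \<Rightarrow> nat" where
  "num_classes M t = card {B \<in> comp_classes M. B \<inter> {1..t} \<noteq> {}}"

definition class_idx :: "('x, 'th, 'ph) mixture_family \<Rightarrow> nat \<Rightarrow> nat" where
  "class_idx M t = (THE m. t \<in> comp_class M m)"

definition class_count :: "('x, 'th, 'ph) mixture_family \<Rightarrow> nat \<Rightarrow> nat \<Rightarrow> nat" where
  "class_count M m t = card (comp_class M m \<inter> {1..t})"


subsection \<open>Class occupancy patterns\<close>

text \<open>
  A pattern is a function \<open>h :: nat \<Rightarrow> nat\<close> with \<open>h m = 0\<close> for \<open>m = 0\<close> and for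
  \<open>m\<close> larger than the number of classes met; this identifies patterns that differ by trailing zeros.
\<close>

definition pattern :: "('x, 'th, 'ph) mixture_family \<Rightarrow> nat \<Rightarrow> (nat \<Rightarrow> nat) \<Rightarrow> nat \<Rightarrow> nat" where
  "pattern M n g m = card {j \<in> comp_class M m. card (alloc n g j) \<ge> 1}"

definition patterns :: "('x, 'th, 'ph) mixture_family \<Rightarrow> nat \<Rightarrow> nat \<Rightarrow> (nat \<Rightarrow> nat) set" where
  "patterns M n t = pattern M n ` memb_star n t"

definition pat_level :: "('x, 'th, 'ph) mixture_family \<Rightarrow> (nat \<Rightarrow> nat) \<Rightarrow> nat" where
  "pat_level M h = (LEAST r. r \<ge> 1 \<and> (\<forall>m\<ge>1. class_count M m r \<ge> h m))"

text \<open>\<open>patterns_at M n t r\<close> is \<open>\<H>\<^sub>r\<^sup>t\<close>.\<close>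

definition patterns_at ::
  "('x, 'th, 'ph) mixture_family \<Rightarrow> nat \<Rightarrow> nat \<Rightarrow> nat \<Rightarrow> (nat \<Rightarrow> nat) set" where
  "patterns_at M n t r = {h \<in> patterns M n t. pat_level M h = r}"

definition memb_pat ::
  "('x, 'th, 'ph) mixture_family \<Rightarrow> nat \<Rightarrow> nat \<Rightarrow> (nat \<Rightarrow> nat) \<Rightarrow> (nat \<Rightarrow> nat) set" where
  "memb_pat M n t h = {g \<in> memb_star n t. pattern M n g = h}"

definition pat_gamma ::
  "('x, 'th, 'ph) mixture_family \<Rightarrow> nat \<Rightarrow> nat \<Rightarrow> (nat \<Rightarrow> nat) \<Rightarrow> real" where
  "pat_gamma M n t h =
     (if h \<in> patterns M n t
      then real (h (class_idx M t)) / real (class_count M (class_idx M t) t) *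
           (\<Prod>m=1..num_classes M t. real (class_count M m t choose h m))
      else 0)"

text \<open>\<open>pat_gamma_upto M n r k h\<close> is \<open>\<gamma>\<^sub>h\<close> with superscript \<open>r,k\<close>.\<close>

definition pat_gamma_upto ::
  "('x, 'th, 'ph) mixture_family \<Rightarrow> nat \<Rightarrow> nat \<Rightarrow> nat \<Rightarrow> (nat \<Rightarrow> nat) \<Rightarrow> real" where
  "pat_gamma_upto M n r k h = 1 / pat_gamma M n r h * (\<Sum>t=r..k. pat_gamma M n t h)"

definition f_dagger ::
  "('x, 'th, 'ph) mixture_family \<Rightarrow> nat \<Rightarrow> (nat \<Rightarrow> 'x) \<Rightarrow> (nat \<Rightarrow> nat) \<Rightarrow> real" where
  "f_dagger M n x h =
     (let s = pat_level M h in \<Sum>g\<in>memb_pat M n s h. f_data M n x s g * f_memb M n s g)"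

end

theory Submission
  imports Defs
begin

text \<open>
  Let \<open>w\<^sub>k = \<Gamma>(\<alpha>\<^sub>0\<^sub>k) / \<Gamma>(\<alpha>\<^sub>0\<^sub>k + n)\<close>. Empty components contribute the factor \<open>1\<close> to both products
  \<open>f(x|k,g,\<phi>\<^sub>k)\<close> and \<open>f(g|k,\<alpha>\<^sub>k)\<close>, and the factor of an occupied component does not depend on \<open>k\<close>
  because the components are nested. Hence, for \<open>g \<in> \<G>\<^sub>k\<close>, the product of the two is \<open>w\<^sub>k U(g)\<close> with a
  weight \<open>U(g)\<close> that no longer mentions \<open>k\<close> (\<open>joint_density_eq\<close>), and the constants of the theorem
  are \<open>a\<^sub>k\<^sub>t = w\<^sub>k / w\<^sub>t\<close>. Splitting \<open>\<G>\<^sub>k\<close> by the largest occupied component gives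
  \<open>f\<^sub>k = w\<^sub>k (S\<^sub>1 + \<dots> + S\<^sub>k)\<close>, where \<open>S\<^sub>t\<close> is the sum of \<open>U\<close> over \<open>\<G>\<^sub>t\<close> starred. In the
  second formula only the last summand \<open>w\<^sub>k S\<^sub>k\<close> is split off, the others adding up to
  \<open>w\<^sub>k / w\<^sub>k\<^sub>-\<^sub>1\<close> times the marginal likelihood for \<open>k - 1\<close>. So everything rests on evaluating \<open>S\<^sub>t\<close>.

  Group the membership vectors \<open>g\<close> by the set \<open>J\<close> of components that they occupy. The sum of \<open>U(g)\<close>
  over all \<open>g\<close> with a given \<open>J\<close> depends only on the class occupancy pattern \<open>h\<close> of \<open>J\<close>: if \<open>J'\<close> has the
  same pattern, relabelling along a bijection from \<open>J\<close> to \<open>J'\<close> that respects the classes preserves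
  \<open>U\<close> (\<open>memb_weight_sum_cong\<close>). Call the common value \<open>V(h)\<close>. The coefficient \<open>\<gamma>\<close> of \<open>h\<close> at \<open>t\<close> is
  nothing but the number of subsets \<open>J\<close> of \<open>{1..t}\<close> with pattern \<open>h\<close> and \<open>t \<in> J\<close>
  (\<open>pat_gamma_eq_card\<close>): in the class of \<open>t\<close>, with \<open>c\<close> members up to \<open>t\<close>, a fraction \<open>h/c\<close> of the
  subsets of size \<open>h\<close> contains \<open>t\<close>. So the vectors of pattern \<open>h\<close> contribute \<open>\<gamma> V(h)\<close> to \<open>S\<^sub>t\<close>.

  Finally, a pattern of level \<open>r\<close> that occurs at some \<open>t\<close> occurs at \<open>r \<le> t\<close> already
  (\<open>patterns_level\<close>). Thus \<open>V(h)\<close> can be eliminated by means of \<open>f\<^sup>\<dagger>\<close>, which equals \<open>w\<^sub>r\<close> times \<open>V(h)\<close> times the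
  coefficient at \<open>r\<close>, and exchanging the sums over \<open>t\<close> and over the patterns gives the first formula.
\<close>

section \<open>Counting subsets and matching fibres\<close>

text \<open>
  A subset of a disjoint union is a family of subsets of the blocks, chosen independently.
\<close>

lemma card_subsets_by_blocks:
  assumes "finite I" and "disjoint_family_on D I" and "\<And>m. m \<in> I \<Longrightarrow> S m \<subseteq> Pow (D m)"
  shows "card {J. J \<subseteq> (\<Union>m\<in>I. D m) \<and> (\<forall>m\<in>I. J \<inter> D m \<in> S m)} = (\<Prod>m\<in>I. card (S m))"
proof -
  let ?A = "{J. J \<subseteq> (\<Union>m\<in>I. D m) \<and> (\<forall>m\<in>I. J \<inter> D m \<in> S m)}"
  have block: "(\<Union>m\<in>I. F m) \<inter> D m = F m" if "F \<in> Pi\<^sub>E I S" "m \<in> I" for F m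
  proof -
    have sub: "F m' \<subseteq> D m'" if "m' \<in> I" for m'
      using \<open>F \<in> Pi\<^sub>E I S\<close> assms(3)[OF that] that by (auto simp: PiE_iff)
    have "F m' \<inter> D m = {}" if "m' \<in> I" "m' \<noteq> m" for m'
      using sub[OF that(1)] disjoint_family_onD[OF assms(2) that(1) \<open>m \<in> I\<close> that(2)] by blast
    then show ?thesis using sub \<open>m \<in> I\<close> by blast
  qed
  have "bij_betw (\<lambda>J. restrict (\<lambda>m. J \<inter> D m) I) ?A (Pi\<^sub>E I S)"
  proof (rule bij_betwI[where g = "\<lambda>F. \<Union>m\<in>I. F m"])
    show "(\<lambda>F. \<Union>m\<in>I. F m) \<in> Pi\<^sub>E I S \<rightarrow> ?A"
    proof
      fix F assume F: "F \<in> Pi\<^sub>E I S"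
      have "F m \<in> S m" if "m \<in> I" for m using F that by auto
      moreover from this have "(\<Union>m\<in>I. F m) \<subseteq> (\<Union>m\<in>I. D m)"
        using assms(3) by blast
      ultimately show "(\<Union>m\<in>I. F m) \<in> ?A" using block[OF F] by auto
    qed
    show "restrict (\<lambda>m. (\<Union>m\<in>I. F m) \<inter> D m) I = F" if "F \<in> Pi\<^sub>E I S" for F
      using block[OF that] that by (auto simp: fun_eq_iff PiE_iff extensional_def)
  qed auto
  then have "card ?A = card (Pi\<^sub>E I S)" by (rule bij_betw_same_card)
  then show ?thesis using assms(1) by (simp add: card_PiE)
qed

text \<open>
  Removing \<open>t\<close> leaves a free choice of \<open>h - 1\<close> of the other elements; the absorption identity for
  binomial coefficients turns their number into the form in which \<open>\<gamma>\<close> is defined.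
\<close>

lemma card_pointed_subsets:
  assumes "finite D" and "t \<in> D" and "1 \<le> h"
  shows "real (card {S. S \<subseteq> D \<and> t \<in> S \<and> card S = h}) =
    real h / real (card D) * real (card D choose h)"
proof -
  have "bij_betw (insert t) {S. S \<subseteq> D - {t} \<and> card S = h - 1} {S. S \<subseteq> D \<and> t \<in> S \<and> card S = h}"
  proof (rule bij_betwI[where g = "\<lambda>S. S - {t}"])
    show "insert t \<in> {S. S \<subseteq> D - {t} \<and> card S = h - 1} \<rightarrow> {S. S \<subseteq> D \<and> t \<in> S \<and> card S = h}"
    proof
      fix S assume S: "S \<in> {S. S \<subseteq> D - {t} \<and> card S = h - 1}"
      then have "finite S" "t \<notin> S" using assms(1) finite_subset[of S D] by auto
      then show "insert t S \<in> {S. S \<subseteq> D \<and> t \<in> S \<and> card S = h}" using S assms by auto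
    qed
  qed auto
  then have "card {S. S \<subseteq> D \<and> t \<in> S \<and> card S = h} = card {S. S \<subseteq> D - {t} \<and> card S = h - 1}"
    by (simp add: bij_betw_same_card)
  also have "\<dots> = (card D - 1 choose (h - 1))"
    using n_subsets[of "D - {t}" "h - 1"] assms by simp
  finally have *: "card {S. S \<subseteq> D \<and> t \<in> S \<and> card S = h} = (card D - 1 choose (h - 1))" .
  have c: "card D \<noteq> 0" using assms by auto
  have "h * (card D choose h) = card D * (card D - 1 choose (h - 1))"
    using binomial_absorption[of "h - 1" "card D"] assms(3) by simp
  then have "real h * real (card D choose h) = real (card D) * real (card D - 1 choose (h - 1))"
    by (metis of_nat_mult)
  then show ?thesis unfolding * using c by (simp add: field_simps)
qed

text \<open>
  Bijections between corresponding fibres of \<open>f\<close> glue together.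
\<close>

lemma ex_bij_betw_fibres:
  assumes "finite A" and "finite B" and "\<And>m. card {a \<in> A. f a = m} = card {b \<in> B. f b = m}"
  obtains \<beta> where "bij_betw \<beta> A B" and "\<And>a. a \<in> A \<Longrightarrow> f (\<beta> a) = f a"
proof -
  have "\<exists>b. bij_betw b {a \<in> A. f a = m} {a \<in> B. f a = m}" for m
    using assms by (intro finite_same_card_bij) auto
  then obtain b where b: "\<And>m. bij_betw (b m) {a \<in> A. f a = m} {a \<in> B. f a = m}" by metis
  define \<beta> where "\<beta> a = b (f a) a" for a
  have in_fibre: "\<beta> a \<in> B \<and> f (\<beta> a) = f a" if "a \<in> A" for a
    using bij_betwE[OF b[of "f a"]] that unfolding \<beta>_def by auto
  have "inj_on \<beta> A"
  proof (rule inj_onI)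
    fix a a' assume a: "a \<in> A" "a' \<in> A" "\<beta> a = \<beta> a'"
    then have "f a = f a'" using in_fibre by metis
    then show "a = a'"
      using bij_betw_imp_inj_on[OF b[of "f a"]] a unfolding \<beta>_def by (auto dest: inj_onD)
  qed
  moreover have "\<beta> ` A = B"
  proof
    show "\<beta> ` A \<subseteq> B" using in_fibre by auto
    show "B \<subseteq> \<beta> ` A"
    proof
      fix y assume "y \<in> B"
      then have "y \<in> b (f y) ` {a \<in> A. f a = f y}"
        using bij_betw_imp_surj_on[OF b[of "f y"]] by auto
      then show "y \<in> \<beta> ` A" unfolding \<beta>_def by force
    qed
  qed
  ultimately show ?thesis using that in_fibre unfolding bij_betw_def by blast
qed


section \<open>The classes of alike components\<close>

abbreviation alike_rel :: "('x, 'th, 'ph) mixture_family \<Rightarrow> (nat \<times> nat) set" where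
  "alike_rel M \<equiv> {(j, k). j \<ge> 1 \<and> k \<ge> 1 \<and> alike M j k}"

lemma equiv_alike: "equiv {1..} (alike_rel M)"
  by (rule equivI) (auto simp: refl_on_def sym_def trans_def alike_def)

lemma comp_classes_member:
  assumes "B \<in> comp_classes M"
  shows "B \<subseteq> {1..}" and "(LEAST j. j \<in> B) \<in> B"
proof -
  show "B \<subseteq> {1..}"
    using assms equiv_alike[of M] by (auto simp: comp_classes_def quotient_def)
  have "B \<noteq> {}"
    using assms in_quotient_imp_non_empty[OF equiv_alike] by (auto simp: comp_classes_def)
  then show "(LEAST j. j \<in> B) \<in> B" by (meson LeastI_ex ex_in_conv)
qed

lemma comp_classes_disjoint:
  assumes "B \<in> comp_classes M" "B' \<in> comp_classes M" "j \<in> B" "j \<in> B'"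
  shows "B = B'"
  using quotient_disj[OF equiv_alike] assms by (fastforce simp: comp_classes_def)

lemma finite_classes_Least_le: "finite {B \<in> comp_classes M. (LEAST j. j \<in> B) \<le> t}"
proof -
  have "inj_on (\<lambda>B. LEAST j. j \<in> B) {B \<in> comp_classes M. (LEAST j. j \<in> B) \<le> t}"
    by (rule inj_onI) (metis (mono_tags, lifting) comp_classes_disjoint comp_classes_member(2) mem_Collect_eq)
  moreover have "(\<lambda>B. LEAST j. j \<in> B) ` {B \<in> comp_classes M. (LEAST j. j \<in> B) \<le> t} \<subseteq> {..t}"
    by auto
  ultimately show ?thesis by (meson finite_atMost finite_subset finite_imageD)
qed

text \<open>
  Disjoint classes have distinct smallest elements, and only finitely many classes have a smaller
  one; so ranking by smallest elements numbers the classes without collisions.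
\<close>

lemma class_rank_inj:
  assumes "B \<in> comp_classes M" "B' \<in> comp_classes M" "class_rank M B = class_rank M B'"
  shows "B = B'"
proof -
  have less: "class_rank M C < class_rank M C'"
    if "C' \<in> comp_classes M" "(LEAST j. j \<in> C) < (LEAST j. j \<in> C')" for C C'
    unfolding class_rank_def
    by (rule psubset_card_mono[OF finite_classes_Least_le]) (use that in force)
  have "(LEAST j. j \<in> B) = (LEAST j. j \<in> B')"
    using less[of B B'] less[of B' B] assms by (metis linorder_neqE_nat nat_less_le)
  then show ?thesis
    using comp_classes_disjoint assms comp_classes_member(2) by metis
qed

lemma class_rank_bounds:
  assumes "B \<in> comp_classes M" "j \<in> B" "j \<le> t"
  shows "class_rank M B \<in> {1..num_classes M t}"
proof -
  have "B \<in> {B' \<in> comp_classes M. (LEAST j. j \<in> B') \<le> (LEAST j. j \<in> B)}"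
    using assms by simp
  then have "class_rank M B \<noteq> 0"
    unfolding class_rank_def using finite_classes_Least_le[of M] by (metis card_eq_0_iff empty_iff)
  have meets: "{B \<in> comp_classes M. B \<inter> {1..t} \<noteq> {}} = {B \<in> comp_classes M. (LEAST j. j \<in> B) \<le> t}"
  proof -
    have "B \<inter> {1..t} \<noteq> {} \<longleftrightarrow> (LEAST j. j \<in> B) \<le> t" if B: "B \<in> comp_classes M" for B
    proof
      assume "B \<inter> {1..t} \<noteq> {}"
      then obtain i where "i \<in> B" "i \<le> t" by auto
      then show "(LEAST j. j \<in> B) \<le> t" by (meson Least_le le_trans)
    next
      assume "(LEAST j. j \<in> B) \<le> t"
      then show "B \<inter> {1..t} \<noteq> {}" using comp_classes_member[OF B] by fastforce
    qed
    then show ?thesis by blast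
  qed
  have "(LEAST j. j \<in> B) \<le> t" using assms by (meson Least_le le_trans)
  then have "class_rank M B \<le> num_classes M t"
    unfolding class_rank_def num_classes_def meets
    by (intro card_mono[OF finite_classes_Least_le]) auto
  then show ?thesis using \<open>class_rank M B \<noteq> 0\<close> by simp
qed

lemma comp_class_eq:
  assumes "B \<in> comp_classes M"
  shows "comp_class M (class_rank M B) = B"
proof -
  have "{B' \<in> comp_classes M. class_rank M B' = class_rank M B} = {B}"
    using class_rank_inj assms by blast
  then show ?thesis by (simp add: comp_class_def)
qed

text \<open>
  Every component lies in exactly one numbered class. From here on the classes are the fibres of
  \<open>class_idx\<close>.
\<close>

lemma comp_class_iff: "j \<in> comp_class M m \<longleftrightarrow> 1 \<le> j \<and> class_idx M j = m"
proof -
  have sub: "1 \<le> j" if "j \<in> comp_class M m" for m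
    using that comp_classes_member(1) by (fastforce simp: comp_class_def)
  have ex1: "\<exists>!m. j \<in> comp_class M m" if "1 \<le> j"
  proof -
    have "alike_rel M `` {j} \<in> comp_classes M" (is "?B \<in> _")
      unfolding comp_classes_def by (rule quotientI) (use that in simp)
    moreover have "j \<in> ?B" using that by (simp add: alike_def)
    ultimately have "j \<in> comp_class M (class_rank M ?B)" by (simp add: comp_class_eq)
    moreover have "m = m'" if "j \<in> comp_class M m" "j \<in> comp_class M m'" for m m'
      using that comp_classes_disjoint by (fastforce simp: comp_class_def)
    ultimately show ?thesis by blast
  qed
  show ?thesis
    using sub ex1 theI'[OF ex1] unfolding class_idx_def by blast
qed

text \<open>
  The classes met by \<open>{1..t}\<close> are the first \<open>num_classes M t\<close> ones, so a product over these indices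
  covers every class that \<open>{1..t}\<close> meets.
\<close>

lemma class_idx_bounds:
  assumes "j \<in> {1..t}"
  shows "class_idx M j \<in> {1..num_classes M t}"
proof -
  have "j \<in> comp_class M (class_idx M j)" using assms by (simp add: comp_class_iff)
  then obtain B where "B \<in> comp_classes M" "class_rank M B = class_idx M j" "j \<in> B"
    by (auto simp: comp_class_def)
  then show ?thesis using class_rank_bounds[of B M j t] assms by simp
qed

lemma alike_if_same_class:
  assumes "1 \<le> i" "1 \<le> j" "class_idx M i = class_idx M j"
  shows "alike M i j"
proof -
  have "i \<in> comp_class M (class_idx M i)" "j \<in> comp_class M (class_idx M i)"
    using assms by (auto simp: comp_class_iff)
  then obtain B where "B \<in> comp_classes M" "i \<in> B" "j \<in> B"
    using class_rank_inj by (fastforce simp: comp_class_def)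
  then show ?thesis by (auto simp: comp_classes_def alike_def quotient_def)
qed


section \<open>Occupied components\<close>

definition occ_pattern :: "('x, 'th, 'ph) mixture_family \<Rightarrow> nat set \<Rightarrow> nat \<Rightarrow> nat" where
  "occ_pattern M J m = card (J \<inter> comp_class M m)"

definition occ_sets :: "('x, 'th, 'ph) mixture_family \<Rightarrow> nat \<Rightarrow> (nat \<Rightarrow> nat) \<Rightarrow> nat set set" where
  "occ_sets M t h = {J. J \<subseteq> {1..t} \<and> t \<in> J \<and> occ_pattern M J = h}"

definition memb_onto :: "nat \<Rightarrow> nat set \<Rightarrow> (nat \<Rightarrow> nat) set" where
  "memb_onto n J = {g \<in> {1..n} \<rightarrow>\<^sub>E J. g ` {1..n} = J}"

lemma memb_iff: "g \<in> memb n t \<longleftrightarrow> g \<in> extensional {1..n} \<and> g ` {1..n} \<subseteq> {1..t}"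
  by (auto simp: memb_def PiE_iff)

lemma memb_star_iff:
  "g \<in> memb_star n t \<longleftrightarrow> g \<in> extensional {1..n} \<and> g ` {1..n} \<subseteq> {1..t} \<and> t \<in> g ` {1..n}"
  unfolding memb_star_def mem_Collect_eq memb_iff by auto

lemma memb_onto_iff: "g \<in> memb_onto n J \<longleftrightarrow> g \<in> extensional {1..n} \<and> g ` {1..n} = J"
  by (auto simp: memb_onto_def PiE_iff)

lemma finite_memb: "finite (memb n t)" "finite (memb_star n t)"
  by (auto simp: memb_def memb_star_def intro!: finite_PiE)

lemma pattern_eq_occ_pattern: "pattern M n g = occ_pattern M (g ` {1..n})"
proof
  fix m
  have "finite (alloc n g j)" for j by (simp add: alloc_def)
  then have "1 \<le> card (alloc n g j) \<longleftrightarrow> j \<in> g ` {1..n}" for j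
    by (auto simp: Suc_le_eq card_gt_0_iff alloc_def)
  then show "pattern M n g m = occ_pattern M (g ` {1..n}) m"
    unfolding pattern_def occ_pattern_def by (intro arg_cong[where f = card]) auto
qed

text \<open>
  The pattern of \<open>g\<close> and membership in \<open>memb_star\<close> are both properties of the range of \<open>g\<close> alone.
\<close>

lemma memb_pat_eq_UN: "memb_pat M n t h = (\<Union>J\<in>occ_sets M t h. memb_onto n J)"
  by (auto simp: memb_pat_def memb_star_iff occ_sets_def memb_onto_iff pattern_eq_occ_pattern)

lemma finite_occ_sets: "finite (occ_sets M t h)"
  by (rule finite_subset[of _ "Pow {1..t}"]) (auto simp: occ_sets_def)

text \<open>
  The index \<open>t\<close> is the largest occupied component, which exists since there is at least one
  observation.
\<close>

lemma memb_eq_UN_memb_star: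
  assumes "1 \<le> n"
  shows "memb n k = (\<Union>t\<in>{1..k}. memb_star n t)"
proof (intro equalityI subsetI)
  fix g assume g: "g \<in> memb n k"
  have ne: "g ` {1..n} \<noteq> {}" using assms by simp
  define t where "t = Max (g ` {1..n})"
  have t: "t \<in> g ` {1..n}" unfolding t_def by (rule Max_in) (use ne in auto)
  have le: "i \<le> t" if "i \<in> g ` {1..n}" for i using that by (simp add: t_def)
  have gk: "g ` {1..n} \<subseteq> {1..k}" "g \<in> extensional {1..n}" using g by (simp_all only: memb_iff)
  have "g ` {1..n} \<subseteq> {1..t}" using gk(1) le by (meson atLeastAtMost_iff subset_iff)
  then have "g \<in> memb_star n t" using gk(2) t by (simp only: memb_star_iff)
  moreover have "t \<in> {1..k}" using t gk(1) by blast
  ultimately show "g \<in> (\<Union>t\<in>{1..k}. memb_star n t)" by blast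
next
  fix g assume "g \<in> (\<Union>t\<in>{1..k}. memb_star n t)"
  then show "g \<in> memb n k" by (fastforce simp: memb_star_iff memb_iff)
qed

lemma memb_star_disjoint:
  assumes "t \<noteq> t'"
  shows "memb_star n t \<inter> memb_star n t' = {}"
  using assms by (fastforce simp: memb_star_iff)

lemma occ_pattern_fibre:
  assumes "J \<subseteq> {1..}"
  shows "occ_pattern M J m = card {j \<in> J. class_idx M j = m}"
  unfolding occ_pattern_def by (intro arg_cong[where f = card]) (use assms in \<open>auto simp: comp_class_iff\<close>)

text \<open>
  Equal patterns mean that \<open>J\<close> and \<open>J'\<close> have equally many members in each class.
\<close>

lemma class_preserving_bij:
  assumes "J \<subseteq> {1..}" "J' \<subseteq> {1..}" "finite J" "finite J'" "occ_pattern M J = occ_pattern M J'"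
  obtains \<beta> where "bij_betw \<beta> J J'" and "\<And>j. j \<in> J \<Longrightarrow> alike M j (\<beta> j)"
proof -
  have "card {j \<in> J. class_idx M j = m} = card {j \<in> J'. class_idx M j = m}" for m
    using assms by (metis occ_pattern_fibre)
  then obtain \<beta> where \<beta>: "bij_betw \<beta> J J'" "\<And>j. j \<in> J \<Longrightarrow> class_idx M (\<beta> j) = class_idx M j"
    using ex_bij_betw_fibres[where f = "class_idx M", OF assms(3,4)] by blast
  have "alike M j (\<beta> j)" if "j \<in> J" for j
    using alike_if_same_class[of j "\<beta> j" M] \<beta> bij_betwE[OF \<beta>(1)] that assms(1,2) by fastforce
  then show ?thesis using that \<beta>(1) by blast
qed

lemma memb_onto_bij:
  assumes "bij_betw \<beta> J J'"
  shows "bij_betw (\<lambda>g. restrict (\<beta> \<circ> g) {1..n}) (memb_onto n J) (memb_onto n J')"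
proof (rule bij_betwI[where g = "\<lambda>g. restrict (inv_into J \<beta> \<circ> g) {1..n}"])
  have comp: "restrict (b \<circ> g) {1..n} \<in> memb_onto n B" if "bij_betw b A B" "g \<in> memb_onto n A" for b A B g
    using bij_betw_imp_surj_on[OF that(1)] that(2) by (auto simp: memb_onto_iff image_comp[symmetric])
  have inv: "bij_betw (inv_into J \<beta>) J' J" using assms by (rule bij_betw_inv_into)
  show "(\<lambda>g. restrict (\<beta> \<circ> g) {1..n}) \<in> memb_onto n J \<rightarrow> memb_onto n J'"
    using comp[OF assms] by blast
  show "(\<lambda>g. restrict (inv_into J \<beta> \<circ> g) {1..n}) \<in> memb_onto n J' \<rightarrow> memb_onto n J"
    using comp[OF inv] by blast
  show "restrict (inv_into J \<beta> \<circ> restrict (\<beta> \<circ> g) {1..n}) {1..n} = g" if "g \<in> memb_onto n J" for g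
    using that bij_betw_inv_into_left[OF assms]
    by (auto simp: memb_onto_def fun_eq_iff PiE_iff extensional_def)
  show "restrict (\<beta> \<circ> restrict (inv_into J \<beta> \<circ> g) {1..n}) {1..n} = g" if "g \<in> memb_onto n J'" for g
    using that bij_betw_inv_into_right[OF assms]
    by (auto simp: memb_onto_def fun_eq_iff PiE_iff extensional_def)
qed

lemma finite_patterns_at: "finite (patterns_at M n t r)"
  by (simp add: patterns_at_def patterns_def finite_memb)

text \<open>
  A subset of \<open>{1..t}\<close> with pattern \<open>h\<close> is a free choice, for each class \<open>m\<close>, of \<open>h m\<close> of its members
  up to \<open>t\<close>; only in the class of \<open>t\<close> is the choice restricted, to the subsets that contain \<open>t\<close>.
\<close>

lemma pat_gamma_eq_card:
  assumes "h \<in> patterns M n t"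
  shows "pat_gamma M n t h = real (card (occ_sets M t h))"
proof -
  define D where "D m = comp_class M m \<inter> {1..t}" for m
  let ?I = "{1..num_classes M t}" and ?i = "class_idx M t"
  obtain g where g: "g \<in> memb_star n t" "occ_pattern M (g ` {1..n}) = h"
    using assms by (auto simp: patterns_def pattern_eq_occ_pattern)
  then have J0: "g ` {1..n} \<subseteq> {1..t}" "t \<in> g ` {1..n}" by (auto simp: memb_star_iff)
  then have t: "t \<in> {1..t}" "t \<in> D ?i" by (auto simp: D_def comp_class_iff)
  then have i: "?i \<in> ?I" using class_idx_bounds by blast
  have "t \<in> g ` {1..n} \<inter> comp_class M ?i" using J0 by (auto simp: comp_class_iff)
  then have "occ_pattern M (g ` {1..n}) ?i \<noteq> 0"
    unfolding occ_pattern_def by (metis card_eq_0_iff empty_iff finite_Int finite_atLeastAtMost finite_imageI)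
  then have "h ?i \<noteq> 0" using g(2) by simp
  have UD: "(\<Union>m\<in>?I. D m) = {1..t}"
    using class_idx_bounds[of _ t M] by (auto simp: D_def comp_class_iff)
  have outside: "occ_pattern M J m = 0" if "J \<subseteq> {1..t}" "m \<notin> ?I" for J m
  proof -
    have "J \<inter> comp_class M m = {}"
      using that class_idx_bounds[of _ t M] by (fastforce simp: comp_class_iff)
    then show ?thesis by (simp add: occ_pattern_def)
  qed
  define S where "S m = {S. S \<subseteq> D m \<and> (m = ?i \<longrightarrow> t \<in> S) \<and> card S = h m}" for m
  have "occ_sets M t h = {J. J \<subseteq> (\<Union>m\<in>?I. D m) \<and> (\<forall>m\<in>?I. J \<inter> D m \<in> S m)}"
  proof -
    have "t \<in> J \<and> occ_pattern M J = h \<longleftrightarrow> (\<forall>m\<in>?I. J \<inter> D m \<in> S m)" if "J \<subseteq> {1..t}" for J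
    proof -
      have "J \<inter> D m = J \<inter> comp_class M m" for m using that by (auto simp: D_def)
      then have "(\<forall>m\<in>?I. J \<inter> D m \<in> S m) \<longleftrightarrow> t \<in> J \<and> (\<forall>m\<in>?I. occ_pattern M J m = h m)"
        using i t unfolding S_def occ_pattern_def by auto
      moreover have "occ_pattern M J m = h m" if "m \<notin> ?I" for m
        using outside[OF \<open>J \<subseteq> {1..t}\<close> that] outside[OF J0(1) that] g(2) by simp
      ultimately show ?thesis by (metis ext)
    qed
    then show ?thesis unfolding UD occ_sets_def by blast
  qed
  moreover have "disjoint_family_on D ?I" "\<And>m. S m \<subseteq> Pow (D m)"
    by (auto simp: S_def D_def disjoint_family_on_def comp_class_iff)
  ultimately have "card (occ_sets M t h) = (\<Prod>m\<in>?I. card (S m))"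
    using card_subsets_by_blocks[of ?I D S] by simp
  also have "\<dots> = card (S ?i) * (\<Prod>m\<in>?I - {?i}. card (D m) choose h m)"
  proof -
    have "card (S m) = (card (D m) choose h m)" if "m \<noteq> ?i" for m
      using that n_subsets[of "D m" "h m"] by (simp add: S_def D_def)
    then show ?thesis using i by (subst prod.remove[of _ ?i]) (auto intro!: prod.cong)
  qed
  finally have "real (card (occ_sets M t h)) = real (h ?i) / real (card (D ?i)) * (real (card (D ?i) choose h ?i)
      * (\<Prod>m\<in>?I - {?i}. real (card (D m) choose h m)))"
    using card_pointed_subsets[of "D ?i" t "h ?i"] t \<open>h ?i \<noteq> 0\<close> by (simp add: S_def D_def)
  also have "real (card (D ?i) choose h ?i) * (\<Prod>m\<in>?I - {?i}. real (card (D m) choose h m)) =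
      (\<Prod>m\<in>?I. real (card (D m) choose h m))"
    using i by (subst prod.remove[of _ ?i]) auto
  finally show ?thesis using assms by (simp add: pat_gamma_def class_count_def D_def)
qed

text \<open>
  By definition of the level \<open>r\<close> there is a set \<open>U\<close> of components up to \<open>r\<close> with pattern \<open>h\<close>. It must
  contain \<open>r\<close>, as otherwise \<open>h\<close> would fit into \<open>{1..r - 1}\<close>. A vector that realises \<open>h\<close> at \<open>t\<close> can be
  relabelled to occupy exactly \<open>U\<close>, so \<open>h\<close> occurs at \<open>r\<close>. The set \<open>U\<close> also witnesses that the
  coefficient at \<open>r\<close>, being a cardinality, does not vanish.
\<close>

lemma patterns_level:
  assumes "h \<in> patterns M n t"
  shows "pat_level M h \<in> {1..t}" and "h \<in> patterns M n (pat_level M h)"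
    and "0 < pat_gamma M n (pat_level M h) h"
proof -
  let ?P = "\<lambda>r. r \<ge> 1 \<and> (\<forall>m\<ge>1. class_count M m r \<ge> h m)" and ?r = "pat_level M h"
  obtain g where g: "g \<in> memb_star n t" and h: "occ_pattern M (g ` {1..n}) = h"
    using assms by (auto simp: patterns_def pattern_eq_occ_pattern)
  let ?J = "g ` {1..n}"
  have J: "?J \<subseteq> {1..t}" "t \<in> ?J" using g by (auto simp: memb_star_iff)
  have P: "?P r" if "K \<subseteq> {1..r}" "occ_pattern M K = h" "1 \<le> r" for K r
    using that by (auto simp: occ_pattern_def class_count_def intro!: card_mono)
  have Pt: "?P t" using P[OF J(1) h] J by auto
  then show r: "?r \<in> {1..t}"
    using LeastI[of ?P t] Least_le[of ?P t] by (simp add: pat_level_def)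
  have Pr: "?P ?r" unfolding pat_level_def using LeastI[of ?P t] Pt by blast
  \<comment> \<open>The level constrains only the indices \<open>m \<ge> 1\<close>; there is no class with index \<open>0\<close>.\<close>
  have h0: "h 0 = 0"
    unfolding h[symmetric] occ_pattern_def using class_idx_bounds[of _ t M] J(1)
    by (fastforce simp: comp_class_iff)
  have "h m \<le> card (comp_class M m \<inter> {1..?r})" for m
    using Pr h0 by (cases "m = 0") (auto simp: class_count_def)
  then have "\<exists>K. K \<subseteq> comp_class M m \<inter> {1..?r} \<and> card K = h m" for m
    by (metis obtain_subset_with_card_n)
  then obtain K where K: "\<And>m. K m \<subseteq> comp_class M m \<inter> {1..?r}" "\<And>m. card (K m) = h m" by metis
  define U where "U = (\<Union>m. K m)"
  have "U \<inter> comp_class M m = K m" for m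
    using K(1) by (fastforce simp: comp_class_iff U_def)
  then have hU: "occ_pattern M U = h" using K(2) by (auto simp: occ_pattern_def fun_eq_iff)
  have U: "U \<subseteq> {1..?r}" using K(1) by (auto simp: U_def)
  obtain \<beta> where \<beta>: "bij_betw \<beta> ?J U"
    using class_preserving_bij[of ?J U M] J(1) U h hU finite_subset[OF U] by fastforce
  have "?r \<in> U"
  proof (rule ccontr)
    assume nU: "?r \<notin> U"
    have lt: "1 \<le> j \<and> j \<le> ?r - 1" if "j \<in> U" for j
    proof -
      have "j \<noteq> ?r" "1 \<le> j" "j \<le> ?r" using that nU U by auto
      then show ?thesis by linarith
    qed
    \<comment> \<open>The level is a positive number, so minimality can be contradicted by \<open>r - 1\<close> only if this is
      positive; that holds because \<open>U\<close>, like \<open>?J\<close>, is nonempty.\<close>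
    have "\<beta> t \<in> U" using \<beta> J(2) by (meson bij_betwE)
    then have "1 \<le> ?r - 1" using lt by fastforce
    then have "?P (?r - 1)" using P[OF _ hU] lt by (meson atLeastAtMost_iff subsetI)
    then have "?r \<le> ?r - 1" unfolding pat_level_def by (rule Least_le)
    then show False using \<open>1 \<le> ?r - 1\<close> by linarith
  qed
  then have K_occ: "U \<in> occ_sets M ?r h" using U hU by (simp add: occ_sets_def)
  have "g \<in> memb_onto n ?J" using g by (simp add: memb_onto_iff memb_star_iff)
  then have "restrict (\<beta> \<circ> g) {1..n} \<in> memb_onto n U"
    using bij_betwE[OF memb_onto_bij[OF \<beta>]] by blast
  then have "restrict (\<beta> \<circ> g) {1..n} \<in> memb_pat M n ?r h"
    unfolding memb_pat_eq_UN using K_occ by blast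
  then show pr: "h \<in> patterns M n ?r" by (auto simp: memb_pat_def patterns_def)
  show "0 < pat_gamma M n ?r h"
    using K_occ finite_occ_sets[of M ?r h] by (auto simp: pat_gamma_eq_card[OF pr] card_gt_0_iff)
qed


section \<open>The joint density factorises\<close>

text \<open>
  Component \<open>j\<close> is read off from the \<open>j\<close>-component mixture, where it occurs first; this makes the
  weight of a membership vector independent of the number of components.
\<close>

definition comp_weight :: "('x, 'th, 'ph) mixture_family \<Rightarrow> (nat \<Rightarrow> 'x) \<Rightarrow> nat \<Rightarrow> nat set \<Rightarrow> real" where
  "comp_weight M x j A = q_marg M x j j A * (Gamma (dir_par M j j + real (card A)) / Gamma (dir_par M j j))"

definition memb_weight :: "('x, 'th, 'ph) mixture_family \<Rightarrow> nat \<Rightarrow> (nat \<Rightarrow> 'x) \<Rightarrow> (nat \<Rightarrow> nat) \<Rightarrow> real" where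
  "memb_weight M n x g = (\<Prod>j\<in>g ` {1..n}. comp_weight M x j (alloc n g j))"

definition dir_const :: "('x, 'th, 'ph) mixture_family \<Rightarrow> nat \<Rightarrow> nat \<Rightarrow> real" where
  "dir_const M n k = Gamma (dir_total M k) / Gamma (dir_total M k + real n)"

lemma comp_weight_alike:
  assumes "alike M i j"
  shows "comp_weight M x i = comp_weight M x j"
  using assms unfolding alike_def comp_weight_def q_marg_def q_integrand_def by (intro ext) simp

text \<open>
  Empty components contribute a factor \<open>1\<close>.
\<close>

lemma prod_occupied:
  assumes "g \<in> memb n k" and "\<And>j. j \<in> {1..k} \<Longrightarrow> c j {} = 1"
  shows "(\<Prod>j=1..k. c j (alloc n g j)) = (\<Prod>j\<in>g ` {1..n}. c j (alloc n g j) :: real)"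
proof -
  have "c j (alloc n g j) = 1" if "j \<in> {1..k} - g ` {1..n}" for j
  proof -
    have "alloc n g j = {}" using that by (auto simp: alloc_def)
    then show ?thesis using assms(2) that by simp
  qed
  then show ?thesis using assms(1) by (intro prod.mono_neutral_right) (auto simp: memb_iff)
qed

context
  fixes M :: "('x, 'th, 'ph) mixture_family" and n :: nat and x :: "nat \<Rightarrow> 'x"
  assumes model: "mixture_model M n x" and nested: "nested_components M"
begin

lemma dir_par_pos: "1 \<le> j \<Longrightarrow> j \<le> k \<Longrightarrow> 0 < dir_par M j k"
  using model by (auto simp: mixture_model_def)

lemma dir_const_pos: "1 \<le> k \<Longrightarrow> 0 < dir_const M n k"
proof -
  assume "1 \<le> k"
  then have "0 < dir_total M k"
    unfolding dir_total_def by (intro sum_pos) (auto simp: dir_par_pos)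
  then show ?thesis by (simp add: dir_const_def Gamma_real_pos add_pos_nonneg)
qed

lemma nested_eq:
  assumes "1 \<le> j" "j \<le> k"
  shows "dir_par M j k = dir_par M j j" and "q_marg M x j k = q_marg M x j j"
proof -
  consider "j = k" | "k \<ge> 2" "j \<in> {1..k - 1}" using assms by force
  then have "dir_par M j k = dir_par M j j \<and> q_marg M x j k = q_marg M x j j"
  proof cases
    case 2
    then show ?thesis using nested
      unfolding nested_components_def q_marg_def q_integrand_def by (auto simp: fun_eq_iff)
  qed simp
  then show "dir_par M j k = dir_par M j j" "q_marg M x j k = q_marg M x j j" by auto
qed

lemma f_memb_pos: "1 \<le> k \<Longrightarrow> 0 < f_memb M n k g"
  unfolding f_memb_def dir_const_def[symmetric]
  by (intro mult_pos_pos prod_pos dir_const_pos ballI divide_pos_pos Gamma_real_pos add_pos_nonneg)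
    (auto simp: dir_par_pos)

lemma f_memb_eq:
  assumes "g \<in> memb n k"
  shows "f_memb M n k g = dir_const M n k *
    (\<Prod>j\<in>g ` {1..n}. Gamma (dir_par M j j + real (card (alloc n g j))) / Gamma (dir_par M j j))"
proof -
  have "Gamma (dir_par M j j) \<noteq> 0" if "j \<in> {1..k}" for j
    using Gamma_real_pos[OF dir_par_pos[of j j]] that by simp
  then show ?thesis
    using prod_occupied[OF assms, of "\<lambda>j A. Gamma (dir_par M j j + real (card A)) / Gamma (dir_par M j j)"]
    unfolding f_memb_def dir_const_def by (simp add: nested_eq[of _ k])
qed

text \<open>
  All dependence on the number of components sits in the Dirichlet normalising constant.
\<close>

lemma joint_density_eq:
  assumes "g \<in> memb n k"
  shows "f_data M n x k g * f_memb M n k g = dir_const M n k * memb_weight M n x g"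
proof -
  have "q_marg M x j j {} = 1" if "j \<in> {1..k}" for j
    using q_marg_empty[OF model, of j j] that by auto
  then have "f_data M n x k g = (\<Prod>j\<in>g ` {1..n}. q_marg M x j j (alloc n g j))"
    using prod_occupied[OF assms, of "\<lambda>j. q_marg M x j j"]
    by (simp add: f_data_def nested_eq[of _ k])
  then show ?thesis
    by (simp only: f_memb_eq[OF assms] memb_weight_def comp_weight_def prod.distrib mult.left_commute)
qed

text \<open>
  Relabelling along \<open>\<beta>\<close> moves each block of observations to an alike component, whose weight is the
  same function of the block.
\<close>

lemma memb_weight_sum_cong:
  assumes "J \<subseteq> {1..}" "J' \<subseteq> {1..}" "finite J" "finite J'" "occ_pattern M J = occ_pattern M J'"
  shows "(\<Sum>g\<in>memb_onto n J. memb_weight M n x g) = (\<Sum>g\<in>memb_onto n J'. memb_weight M n x g)"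
proof -
  obtain \<beta> where \<beta>: "bij_betw \<beta> J J'" "\<And>j. j \<in> J \<Longrightarrow> alike M j (\<beta> j)"
    using class_preserving_bij[OF assms] by blast
  have weight: "memb_weight M n x (restrict (\<beta> \<circ> g) {1..n}) = memb_weight M n x g"
    if g: "g \<in> memb_onto n J" for g
  proof -
    let ?g = "restrict (\<beta> \<circ> g) {1..n}"
    have J: "g ` {1..n} = J" using g by (simp add: memb_onto_iff)
    have inj: "inj_on \<beta> J" using \<beta>(1) by (rule bij_betw_imp_inj_on)
    have "?g ` {1..n} = \<beta> ` J" using J by (auto simp: image_comp[symmetric])
    then have "memb_weight M n x ?g = (\<Prod>j\<in>J. comp_weight M x (\<beta> j) (alloc n ?g (\<beta> j)))"
      by (simp add: memb_weight_def prod.reindex[OF inj])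
    also have "\<dots> = (\<Prod>j\<in>J. comp_weight M x j (alloc n g j))"
    proof (rule prod.cong)
      fix j assume j: "j \<in> J"
      have "alloc n ?g (\<beta> j) = alloc n g j"
        using J inj j by (auto simp: alloc_def dest: inj_onD)
      then show "comp_weight M x (\<beta> j) (alloc n ?g (\<beta> j)) = comp_weight M x j (alloc n g j)"
        using comp_weight_alike[OF \<beta>(2)[OF j]] by metis
    qed simp
    finally show ?thesis unfolding memb_weight_def[of _ _ _ g] J .
  qed
  show ?thesis
    using sum.reindex_bij_betw[OF memb_onto_bij[OF \<beta>(1)], of "memb_weight M n x" n] weight by simp
qed

lemma sum_memb_pat:
  assumes "J0 \<in> occ_sets M s h"
  shows "(\<Sum>g\<in>memb_pat M n t h. memb_weight M n x g) =
    real (card (occ_sets M t h)) * (\<Sum>g\<in>memb_onto n J0. memb_weight M n x g)"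
proof -
  have "(\<Sum>g\<in>memb_pat M n t h. memb_weight M n x g) =
      (\<Sum>J\<in>occ_sets M t h. \<Sum>g\<in>memb_onto n J. memb_weight M n x g)"
    unfolding memb_pat_eq_UN
  proof (rule sum.UNION_disjoint[OF finite_occ_sets])
    show "\<forall>J\<in>occ_sets M t h. finite (memb_onto n J)"
      by (auto simp: memb_onto_def occ_sets_def intro!: finite_PiE intro: finite_subset)
  qed (auto simp: memb_onto_iff)
  also have "\<dots> = (\<Sum>J\<in>occ_sets M t h. \<Sum>g\<in>memb_onto n J0. memb_weight M n x g)"
    using assms
    by (intro sum.cong memb_weight_sum_cong) (auto simp: occ_sets_def intro: finite_subset)
  finally show ?thesis by simp
qed

text \<open>
  Both the sum at \<open>t\<close> and the one at the level \<open>r\<close>, which is \<open>f_dagger\<close> up to \<open>dir_const M n r\<close>, are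
  multiples of the same sum over the vectors that occupy a fixed set with pattern \<open>h\<close>.
\<close>

lemma sum_memb_pat_eq_f_dagger:
  assumes "h \<in> patterns_at M n r r"
  shows "(\<Sum>g\<in>memb_pat M n t h. memb_weight M n x g) =
    pat_gamma M n t h / pat_gamma M n r h * f_dagger M n x h / dir_const M n r"
proof -
  have h: "h \<in> patterns M n r" "pat_level M h = r" using assms by (auto simp: patterns_at_def)
  have r: "1 \<le> r" and pos: "0 < pat_gamma M n r h" using patterns_level[OF h(1)] h(2) by auto
  then obtain J0 where J0: "J0 \<in> occ_sets M r h"
    unfolding pat_gamma_eq_card[OF h(1)] by (metis card.empty equals0I of_nat_0 less_irrefl)
  let ?V = "\<Sum>g\<in>memb_onto n J0. memb_weight M n x g"
  have "f_dagger M n x h = (\<Sum>g\<in>memb_pat M n r h. dir_const M n r * memb_weight M n x g)"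
    unfolding f_dagger_def Let_def h(2)
    by (intro sum.cong joint_density_eq) (auto simp: memb_pat_def memb_star_def)
  then have dagger: "f_dagger M n x h = dir_const M n r * (pat_gamma M n r h * ?V)"
    using sum_memb_pat[OF J0, of r] by (simp add: sum_distrib_left[symmetric] pat_gamma_eq_card[OF h(1)])
  have "(\<Sum>g\<in>memb_pat M n t h. memb_weight M n x g) = pat_gamma M n t h * ?V"
  proof (cases "h \<in> patterns M n t")
    case True
    then show ?thesis using sum_memb_pat[OF J0, of t] by (simp add: pat_gamma_eq_card)
  next
    case False
    then have "memb_pat M n t h = {}" by (auto simp: memb_pat_def patterns_def)
    then show ?thesis using False by (simp add: pat_gamma_def)
  qed
  then show ?thesis using dagger pos dir_const_pos[OF r] by simp
qed

text \<open>
  Every pattern that occurs at \<open>t\<close> has a level \<open>r \<le> k\<close> and occurs at \<open>r\<close>; the other patterns in the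
  sum contribute zero. Summing up to \<open>k\<close> instead of \<open>t\<close> gives all \<open>t \<le> k\<close> the same index set, so
  that the sum over \<open>t\<close> can be exchanged with it.
\<close>

lemma sum_memb_star:
  assumes "t \<le> k"
  shows "(\<Sum>g\<in>memb_star n t. memb_weight M n x g) =
    (\<Sum>r=1..k. \<Sum>h\<in>patterns_at M n r r.
       pat_gamma M n t h / pat_gamma M n r h * f_dagger M n x h / dir_const M n r)"
proof -
  let ?H = "\<Union>r\<in>{1..k}. patterns_at M n r r"
  have "pattern M n g \<in> ?H" if "g \<in> memb_star n t" for g
  proof -
    have "pattern M n g \<in> patterns M n t" using that by (auto simp: patterns_def)
    from patterns_level[OF this] show ?thesis using assms by (auto simp: patterns_at_def)
  qed
  then have "(\<Sum>g\<in>memb_star n t. memb_weight M n x g) =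
      (\<Sum>h\<in>?H. \<Sum>g\<in>memb_pat M n t h. memb_weight M n x g)"
    unfolding memb_pat_def
    by (intro sum.group[symmetric]) (auto simp: finite_memb finite_patterns_at)
  also have "\<dots> = (\<Sum>r=1..k. \<Sum>h\<in>patterns_at M n r r. \<Sum>g\<in>memb_pat M n t h. memb_weight M n x g)"
    by (rule sum.UNION_disjoint) (auto simp: finite_patterns_at, auto simp: patterns_at_def)
  finally show ?thesis by (simp add: sum_memb_pat_eq_f_dagger)
qed

lemma f_marg_eq: "f_marg M n x k = dir_const M n k * (\<Sum>t=1..k. \<Sum>g\<in>memb_star n t. memb_weight M n x g)"
proof -
  have n: "1 \<le> n" using model by (simp add: mixture_model_def)
  have "f_marg M n x k = dir_const M n k * (\<Sum>g\<in>memb n k. memb_weight M n x g)"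
    by (simp add: f_marg_def joint_density_eq sum_distrib_left)
  also have "(\<Sum>g\<in>memb n k. memb_weight M n x g) = (\<Sum>t=1..k. \<Sum>g\<in>memb_star n t. memb_weight M n x g)"
    unfolding memb_eq_UN_memb_star[OF n]
    by (rule sum.UNION_disjoint) (auto simp: finite_memb memb_star_disjoint)
  finally show ?thesis .
qed

lemma f_memb_ratio:
  assumes "1 \<le> t" "t \<le> k" "g \<in> memb n t"
  shows "f_memb M n k g / f_memb M n t g = dir_const M n k / dir_const M n t"
proof -
  have "g \<in> memb n k" using assms by (fastforce simp: memb_iff)
  then obtain P where P: "f_memb M n k g = dir_const M n k * P" "f_memb M n t g = dir_const M n t * P"
    using f_memb_eq assms(3) by blast
  then have "P \<noteq> 0" using f_memb_pos[OF assms(1), of g] by auto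
  then show ?thesis by (simp add: P)
qed

end


section \<open>The recursion\<close>

theorem theorem3p2:
  fixes M :: "('x, 'th, 'ph) mixture_family"
    and n :: nat and x :: "nat \<Rightarrow> 'x" and a :: "nat \<Rightarrow> nat \<Rightarrow> real"
  assumes "mixture_model M n x"
    and "nested_components M"
    and "\<And>t k g. 1 \<le> t \<Longrightarrow> t < k \<Longrightarrow> g \<in> memb_star n t \<Longrightarrow>
           f_data M n x k g = f_data M n x t g"
    and "\<And>t k g. 1 \<le> t \<Longrightarrow> t < k \<Longrightarrow> g \<in> memb_star n t \<Longrightarrow>
           f_memb M n k g / f_memb M n t g = a k t"
    and "\<And>k. 1 \<le> k \<Longrightarrow> a k k = 1"
  shows "(\<forall>k\<ge>1. f_marg M n x k =
            (\<Sum>r=1..k. a k r *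
               (\<Sum>h\<in>patterns_at M n r r. pat_gamma_upto M n r k h * f_dagger M n x h))) \<and>
         (\<forall>k\<ge>2. f_marg M n x k =
            a k (k - 1) * f_marg M n x (k - 1) +
            (\<Sum>r=1..k. a k r *
               (\<Sum>h\<in>patterns_at M n r r.
                  pat_gamma M n k h / pat_gamma M n r h * f_dagger M n x h)))"
proof -
  note model = assms(1) and nested = assms(2)
  let ?w = "dir_const M n" and ?S = "\<lambda>t. \<Sum>g\<in>memb_star n t. memb_weight M n x g"
  have n: "1 \<le> n" using model by (simp add: mixture_model_def)
  have w: "0 < ?w k" if "1 \<le> k" for k using dir_const_pos[OF model nested that] .
  have a: "a k t = ?w k / ?w t" if "1 \<le> t" "t \<le> k" for k t
  proof (cases "t = k")
    case True
    then show ?thesis using assms(5)[of k] w[of k] that by simp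
  next
    case False
    \<comment> \<open>The hypothesis on the ratios determines \<open>a k t\<close> only if \<open>memb_star n t\<close> is nonempty; the vector
      that puts all observations into component \<open>t\<close> is a member.\<close>
    have g: "restrict (\<lambda>_. t) {1..n} \<in> memb_star n t" using that n by (auto simp: memb_star_iff)
    have "?w k / ?w t = f_memb M n k (restrict (\<lambda>_. t) {1..n}) / f_memb M n t (restrict (\<lambda>_. t) {1..n})"
      using f_memb_ratio[OF model nested that] g by (simp add: memb_star_def)
    then show ?thesis using assms(4)[OF that(1) _ g] that False by simp
  qed
  have star: "?w k * ?S t = (\<Sum>r=1..k. a k r * (\<Sum>h\<in>patterns_at M n r r.
      pat_gamma M n t h / pat_gamma M n r h * f_dagger M n x h))" if "t \<le> k" for t k
    unfolding sum_memb_star[OF model nested that] sum_distrib_left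
    by (intro sum.cong) (auto simp: a)
  have one: "f_marg M n x k = (\<Sum>r=1..k. a k r *
      (\<Sum>h\<in>patterns_at M n r r. pat_gamma_upto M n r k h * f_dagger M n x h))" for k
  proof -
    have upto: "(\<Sum>t=1..k. pat_gamma M n t h / pat_gamma M n r h) = pat_gamma_upto M n r k h"
      if "r \<in> {1..k}" "h \<in> patterns_at M n r r" for r h
    proof -
      \<comment> \<open>A pattern that occurs at \<open>t\<close> has level at most \<open>t\<close>, so the sum effectively starts at \<open>t = r\<close>.\<close>
      have "pat_gamma M n t h = 0" if "t < r" for t
      proof -
        have "h \<notin> patterns M n t"
          using patterns_level(1)[of h M n t] \<open>h \<in> _\<close> that by (auto simp: patterns_at_def)
        then show ?thesis by (simp add: pat_gamma_def)
      qed
      then have "(\<Sum>t=1..k. pat_gamma M n t h) = (\<Sum>t=r..k. pat_gamma M n t h)"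
        using that(1) by (intro sum.mono_neutral_right) auto
      then show ?thesis by (simp add: pat_gamma_upto_def sum_divide_distrib[symmetric])
    qed
    have "f_marg M n x k = (\<Sum>t=1..k. ?w k * ?S t)"
      by (simp add: f_marg_eq[OF model nested] sum_distrib_left)
    also have "\<dots> = (\<Sum>t=1..k. \<Sum>r=1..k. a k r * (\<Sum>h\<in>patterns_at M n r r.
        pat_gamma M n t h / pat_gamma M n r h * f_dagger M n x h))"
      by (intro sum.cong) (auto simp: star)
    also have "\<dots> = (\<Sum>r=1..k. \<Sum>t=1..k. a k r * (\<Sum>h\<in>patterns_at M n r r.
        pat_gamma M n t h / pat_gamma M n r h * f_dagger M n x h))"
      by (rule sum.swap)
    also have "\<dots> = (\<Sum>r=1..k. a k r * (\<Sum>h\<in>patterns_at M n r r.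
        (\<Sum>t=1..k. pat_gamma M n t h / pat_gamma M n r h) * f_dagger M n x h))"
      unfolding sum_distrib_left[symmetric] sum_distrib_right
      by (intro sum.cong arg_cong2[where f = "(*)"] refl sum.swap)
    also have "\<dots> = (\<Sum>r=1..k. a k r *
        (\<Sum>h\<in>patterns_at M n r r. pat_gamma_upto M n r k h * f_dagger M n x h))"
      by (intro sum.cong arg_cong2[where f = "(*)"] upto) auto
    finally show ?thesis .
  qed
  have two: "f_marg M n x k = a k (k - 1) * f_marg M n x (k - 1) + (\<Sum>r=1..k. a k r *
      (\<Sum>h\<in>patterns_at M n r r. pat_gamma M n k h / pat_gamma M n r h * f_dagger M n x h))"
    if k: "2 \<le> k" for k
  proof -
    have "(\<Sum>t=1..k. ?S t) = (\<Sum>t=1..k - 1. ?S t) + ?S k"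
      using sum.nat_ivl_Suc'[of 1 "k - 1" ?S] k by simp
    then have "f_marg M n x k = ?w k * (\<Sum>t=1..k - 1. ?S t) + ?w k * ?S k"
      by (simp add: f_marg_eq[OF model nested] algebra_simps)
    also have "?w k * (\<Sum>t=1..k - 1. ?S t) = a k (k - 1) * f_marg M n x (k - 1)"
    proof -
      have "1 \<le> k - 1" using k by simp
      then have "a k (k - 1) * ?w (k - 1) = ?w k" using a[of "k - 1" k] w[of "k - 1"] by simp
      then show ?thesis by (simp only: f_marg_eq[OF model nested] mult.assoc[symmetric])
    qed
    finally show ?thesis using star[of k k] by simp
  qed
  show ?thesis using one two by blast
qed

end
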